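(* For every $n\ge1$, the periodic points of the map $s_{\{123,132\}}:S_n\to S_n$ are exactly the half-decreasing permutations of length $n$.
   Context: A point $a$ is periodic for $f:A\to A$ if $f^k(a)=a$ for some integer $k>0$. A permutation $\pi$ of length $n$ is half-decreasing if the subsequence $\pi(n-1)\pi(n-3)\cdots\pi(2)$ (for odd $n$), respectively $\pi(n-1)\pi(n-3)\cdots\pi(3)$ (for even $n$), is literally equal to $1\,2\cdots\lfloor\frac{n-1}{2}\rfloor$ (i.e. $\pi(n-1)=1$, $\pi(n-3)=2$, etc.). A sequence of distinct integers contains a permutation $\tau$ if some subsequence is order-isomorphic to $\tau$; otherwise it avoids $\tau$. For a set $T$ of permutations, the map $s_T$ is defined by: read the input permutation left to right with an initially empty stack and output; at each step, if there is a next input element and pushing it keeps the stack contents, read from top to bottom, $T$-avoiding, push it; otherwise pop the top of the stack and append it to the output; stop when input and stack are empty; the output is $s_T(\pi)$. *)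

theory Defs
  imports Main "HOL-Library.Sublist" "HOL-Combinatorics.Multiset_Permutations"
begin

text \<open>
  A permutation of length \<open>n\<close> is given in one-line notation, as an element of
  \<^term>\<open>permutations_of_set {1..n}\<close>; so \<open>\<pi>(i)\<close> is the list entry \<open>\<pi> ! (i - 1)\<close>.
\<close>

definition order_isomorphic :: "nat list \<Rightarrow> nat list \<Rightarrow> bool" where
  "order_isomorphic xs ys \<longleftrightarrow>
     length xs = length ys \<and>
     (\<forall>i<length xs. \<forall>j<length xs. xs ! i < xs ! j \<longleftrightarrow> ys ! i < ys ! j)"

definition contains :: "nat list \<Rightarrow> nat list \<Rightarrow> bool" where
  "contains xs \<tau> \<longleftrightarrow> (\<exists>ys. subseq ys xs \<and> order_isomorphic ys \<tau>)"

definition avoids :: "nat list set \<Rightarrow> nat list \<Rightarrow> bool" where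
  "avoids T xs \<longleftrightarrow> (\<forall>\<tau>\<in>T. \<not> contains xs \<tau>)"

text \<open>
  \<open>stack_run T stk inp\<close> is the output still to be produced from the current stack (head = top)
  and the remaining input. If not even a one-element stack avoids \<open>T\<close>, the procedure gets stuck
  with an empty stack; by convention it then stops. This needs a pattern of length at most one
  in \<open>T\<close>.
\<close>

function stack_run :: "nat list set \<Rightarrow> nat list \<Rightarrow> nat list \<Rightarrow> nat list" where
  "stack_run T [] [] = []"
| "stack_run T (t # stk) [] = t # stack_run T stk []"
| "stack_run T [] (x # inp) = (if avoids T [x] then stack_run T [x] inp else [])"
| "stack_run T (t # stk) (x # inp) =
     (if avoids T (x # t # stk) then stack_run T (x # t # stk) inp
      else t # stack_run T stk (x # inp))"
  by pat_completeness auto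
termination
  by (relation "measure (\<lambda>(T, stk, inp). length stk + 2 * length inp)") auto

definition stack_map :: "nat list set \<Rightarrow> nat list \<Rightarrow> nat list" where
  "stack_map T \<pi> = stack_run T [] \<pi>"

definition periodic_points :: "('a \<Rightarrow> 'a) \<Rightarrow> 'a set \<Rightarrow> 'a set" where
  "periodic_points f A = {a \<in> A. \<exists>k>0. (f ^^ k) a = a}"

text \<open>
  With 1-based positions the condition reads \<open>\<pi>(n + 1 - 2i) = i\<close>, that is \<open>\<pi>(n - 1) = 1\<close>,
  \<open>\<pi>(n - 3) = 2\<close> and so on; the last position is 2 for odd \<open>n\<close> and 3 for even \<open>n\<close>.
\<close>

definition half_decreasing :: "nat list \<Rightarrow> bool" where
  "half_decreasing \<pi> \<longleftrightarrow>
     (\<forall>i\<in>{1..(length \<pi> - 1) div 2}. \<pi> ! (length \<pi> - 2 * i) = i)"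

lemma avoids_singleton:
  assumes "\<And>\<tau>. \<tau> \<in> T \<Longrightarrow> length \<tau> \<ge> 2"
  shows "avoids T [x]"
  unfolding avoids_def contains_def order_isomorphic_def
proof (intro ballI notI, elim exE conjE)
  fix \<tau> ys assume "\<tau> \<in> T" "subseq ys [x]" "length ys = length \<tau>"
  then show False
    using assms[of \<tau>] list_emb_length[of "(=)" ys "[x]"] by simp
qed

lemma mset_stack_run:
  assumes "\<And>\<tau>. \<tau> \<in> T \<Longrightarrow> length \<tau> \<ge> 2"
  shows "mset (stack_run T stk inp) = mset stk + mset inp"
  using assms
  by (induction T stk inp rule: stack_run.induct) (simp_all add: avoids_singleton)

lemma stack_map_permutation:
  assumes "\<And>\<tau>. \<tau> \<in> T \<Longrightarrow> length \<tau> \<ge> 2" and "\<pi> \<in> permutations_of_set A"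
  shows "stack_map T \<pi> \<in> permutations_of_set A"
proof -
  have "mset (stack_map T \<pi>) = mset \<pi>"
    using mset_stack_run[OF assms(1)] by (simp add: stack_map_def)
  then show ?thesis
    using assms(2) unfolding permutations_of_set_def
    by (auto dest: mset_eq_setD mset_eq_imp_distinct_iff)
qed

end

theory Submission
  imports Defs
begin

text \<open>
  A stack entry may have at most one larger entry below it. Hence the first letter stays at the
  bottom until the end, and a letter \<open>m\<close> smaller than everything before it clears the stack down to
  that first letter. Write a permutation whose letters \<open>1, \<dots>, k\<close> are already where a
  half-decreasing permutation has them as \<open>P k b\<^sub>1 (k - 1) b\<^sub>2 \<dots> 1 b\<^sub>k\<close>. The map keeps
  \<open>1, \<dots>, k\<close> in place and lets the other letters move through a queue: the first letter of \<open>P\<close> is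
  appended to \<open>b\<^sub>1 \<dots> b\<^sub>k\<close>, and the front of the queue becomes the last letter of the new \<open>P\<close>.
  If \<open>P\<close> has at most two letters, the permutation is half-decreasing and this is a rotation, so it is
  periodic. Otherwise the letter \<open>k + 1\<close> eventually leaves the queue, lands in \<open>P\<close> at a position other
  than the first, and is put in its place in the next step.
\<close>

section \<open>Pattern avoidance for short stacks\<close>

definition patterns :: "nat list set" where
  "patterns = {[1, 2, 3], [1, 3, 2]}"

abbreviation sort_map :: "nat list \<Rightarrow> nat list" where
  "sort_map \<equiv> stack_map patterns"

text \<open>A letter on top of two distinct larger ones forms 123 or 132 with them, according to
  which of the two is larger.\<close>

lemma not_avoids_patterns:
  assumes "m < t" "m < u" "t \<noteq> u"
  shows "\<not> avoids patterns (m # t # u # S)"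
proof -
  have "subseq [m, t, u] (m # t # u # S)" by simp
  moreover have "order_isomorphic [m, t, u] [1, 2, 3] \<or> order_isomorphic [m, t, u] [1, 3, 2]"
    using assms unfolding order_isomorphic_def
    by (cases "t < u") (auto simp: less_Suc_eq numeral_3_eq_3)
  ultimately show ?thesis
    unfolding avoids_def contains_def patterns_def by blast
qed

lemma avoids_patterns_short:
  assumes "length xs \<le> 2"
  shows "avoids patterns xs"
proof -
  have False if "subseq ys xs" "order_isomorphic ys \<tau>" "\<tau> \<in> patterns" for ys \<tau>
  proof -
    have "length ys = 3" using that(2,3) by (auto simp: order_isomorphic_def patterns_def)
    then show False using list_emb_length[OF that(1)] assms by simp
  qed
  then show ?thesis unfolding avoids_def contains_def by blast
qed

text \<open>Only the whole stack is long enough to be a copy of a pattern, and both patterns begin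
  with an ascent.\<close>

lemma avoids_patterns_descent:
  assumes "m < x"
  shows "avoids patterns [x, m, a]"
proof -
  have False if sub: "subseq ys [x, m, a]" and iso: "order_isomorphic ys \<tau>" and \<tau>: "\<tau> \<in> patterns"
    for ys \<tau>
  proof -
    have len: "length ys = 3" using iso \<tau> by (auto simp: order_isomorphic_def patterns_def)
    then have "ys = [x, m, a]" using subseq_same_length[OF sub] by simp
    moreover have "ys ! 0 < ys ! 1"
    proof -
      have "\<tau> ! 0 < \<tau> ! 1" using \<tau> by (auto simp: patterns_def)
      moreover have "(ys ! 0 < ys ! 1) = (\<tau> ! 0 < \<tau> ! 1)"
        using iso len unfolding order_isomorphic_def by simp
      ultimately show ?thesis by simp
    qed
    ultimately show False using assms by simp
  qed
  then show ?thesis unfolding avoids_def contains_def by blast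
qed

lemma length_ge_2_patterns: "\<tau> \<in> patterns \<Longrightarrow> length \<tau> \<ge> 2"
  by (auto simp: patterns_def)

lemma mset_sort_map: "mset (sort_map \<pi>) = mset \<pi>"
  using mset_stack_run[OF length_ge_2_patterns] by (simp add: stack_map_def)

lemma set_sort_map: "set (sort_map \<pi>) = set \<pi>"
  by (rule mset_eq_setD) (rule mset_sort_map)

lemma distinct_sort_map: "distinct (sort_map \<pi>) = distinct \<pi>"
  by (rule mset_eq_imp_distinct_iff) (rule mset_sort_map)

lemma length_sort_map: "length (sort_map \<pi>) = length \<pi>"
  by (rule mset_eq_length) (rule mset_sort_map)

section \<open>The bottom of the stack and letters smaller than all earlier ones\<close>

lemma sort_map_Cons: "sort_map (a # P) = stack_run patterns [a] P"
  by (simp add: stack_map_def avoids_patterns_short)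

lemma stack_run_empty_input [simp]: "stack_run T S [] = S"
  by (induction S) auto

lemma length_stack_run: "length (stack_run patterns S P) = length S + length P"
  using mset_stack_run[OF length_ge_2_patterns, of _ S P]
  by (metis size_mset size_union)

text \<open>As long as two letters remain, \<open>m\<close> would form a pattern with the top two,
  so the top is popped. This goes on until only \<open>a\<close> is left.\<close>

lemma stack_run_smaller:
  assumes "distinct S" "\<And>x. x \<in> set S \<Longrightarrow> m < x" "a \<notin> set S" "m < a"
  shows "stack_run patterns (S @ [a]) (m # R) = S @ stack_run patterns [a] (m # R)"
  using assms
proof (induction S)
  case Nil
  then show ?case by simp
next
  case (Cons t S)
  have "\<not> avoids patterns (m # t # S @ [a])"
  proof (cases S)
    case Nil
    with Cons.prems show ?thesis using not_avoids_patterns[of m t a "[]"] by auto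
  next
    case (Cons u U)
    with Cons.prems show ?thesis using not_avoids_patterns[of m t u "U @ [a]"] by auto
  qed
  with Cons show ?case by simp
qed

text \<open>Until \<open>m\<close> arrives the run is the one on \<open>P\<close> alone. Then
  \<open>m\<close> forces out exactly what the end of input would, except for \<open>a\<close>; this
  is the letter that \<open>butlast\<close> removes.\<close>

lemma stack_run_append_smaller:
  assumes "distinct (S @ a # P)" "\<And>x. x \<in> set (S @ a # P) \<Longrightarrow> m < x"
  shows "stack_run patterns (S @ [a]) (P @ m # R) =
    butlast (stack_run patterns (S @ [a]) P) @ stack_run patterns [m, a] R"
  using assms
proof (induction patterns "S @ [a]" P arbitrary: S rule: stack_run.induct)
  case 1
  then show ?case by simp
next
  case (2 t stk)
  \<comment> \<open>Two letters cannot contain a pattern of length three, so \<open>m\<close> is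
    pushed onto the lone \<open>a\<close>.\<close>
  have "stack_run patterns [a] (m # R) = stack_run patterns [m, a] R"
    by (simp add: avoids_patterns_short)
  then show ?case
    using stack_run_smaller[of S m a R] 2 by simp
next
  case (3 x inp)
  then show ?case by simp
next
  case (4 t stk x inp)
  show ?case
  proof (cases "avoids patterns (x # t # stk)")
    case True
    have "stack_run patterns ((x # S) @ [a]) (inp @ m # R) =
      butlast (stack_run patterns ((x # S) @ [a]) inp) @ stack_run patterns [m, a] R"
      using 4 True by (intro 4(1)) auto
    then show ?thesis using True by (simp flip: 4(3))
  next
    case False
    \<comment> \<open>A failed push means that \<open>a\<close> is not alone, so the popped letter
      is not \<open>a\<close> and the stack keeps the form required by the induction.\<close>
    then have "S \<noteq> []" using 4(3) avoids_patterns_short[of "[x, a]"] by (cases S) auto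
    then obtain S' where S: "S = t # S'" "stk = S' @ [a]" using 4(3) by (cases S) auto
    have "stack_run patterns (S' @ [a]) ((x # inp) @ m # R) =
      butlast (stack_run patterns (S' @ [a]) (x # inp)) @ stack_run patterns [m, a] R"
      using 4(4,5) S(1) by (intro 4(2)[OF False S(2)]) auto
    \<comment> \<open>Nonemptiness lets \<open>butlast\<close> commute with prefixing the popped
      letter \<open>t\<close>.\<close>
    moreover have "stack_run patterns (S' @ [a]) (x # inp) \<noteq> []"
      using length_stack_run[of "S' @ [a]" "x # inp"] by auto
    ultimately show ?thesis using False S by simp
  qed
qed

lemma sort_map_append_smaller:
  assumes "P \<noteq> []" "distinct P" "\<And>x. x \<in> set P \<Longrightarrow> m < x"
  shows "sort_map (P @ m # R) = butlast (sort_map P) @ stack_run patterns [m, hd P] R"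
  using assms stack_run_append_smaller[of "[]" "hd P" "tl P" m R]
  by (cases P) (auto simp: sort_map_Cons)

text \<open>Any letter can be pushed onto \<open>a\<close> alone, so \<open>a\<close> is popped only
  after the input is exhausted.\<close>

lemma last_stack_run: "last (stack_run patterns (S @ [a]) P) = a"
proof (induction patterns "S @ [a]" P arbitrary: S rule: stack_run.induct)
  case (2 t stk)
  then show ?case by simp
next
  case (4 t stk x inp)
  show ?case
  proof (cases "avoids patterns (x # t # stk)")
    case True
    have "last (stack_run patterns ((x # S) @ [a]) inp) = a"
      by (rule 4(1)[OF True]) (simp add: 4(3))
    then show ?thesis using True by (simp flip: 4(3))
  next
    case False
    then have "S \<noteq> []" using 4(3) avoids_patterns_short[of "[x, a]"] by (cases S) auto
    then obtain S' where S: "S = t # S'" "stk = S' @ [a]" using 4(3) by (cases S) auto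
    have "stack_run patterns (S' @ [a]) (x # inp) \<noteq> []"
      using length_stack_run[of "S' @ [a]" "x # inp"] by auto
    then show ?thesis using 4(2)[OF False S(2)] False S by simp
  qed
qed auto

lemma last_sort_map: "P \<noteq> [] \<Longrightarrow> last (sort_map P) = hd P"
  using last_stack_run[of "[]"] by (cases P) (auto simp: sort_map_Cons)

text \<open>Each letter of \<open>Y\<close> exceeds \<open>m\<close>, so it can be pushed directly
  onto \<open>m\<close>, where it creates a descent. Hence \<open>m\<close> is never popped while
  input remains.\<close>

lemma stack_run_keeps_bottom:
  assumes "\<And>y. y \<in> set Y \<Longrightarrow> m < y"
  shows "\<exists>Z. stack_run patterns (S @ [m, a]) Y = Z @ [m, a]"
  using assms
proof (induction patterns "S @ [m, a]" Y arbitrary: S rule: stack_run.induct)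
  case (2 t stk)
  then show ?case by simp
next
  case (4 t stk x inp)
  show ?case
  proof (cases "avoids patterns (x # t # stk)")
    case True
    have "\<exists>Z. stack_run patterns ((x # S) @ [m, a]) inp = Z @ [m, a]"
      using 4(4) by (intro 4(1)[OF True]) (simp_all add: 4(3))
    then show ?thesis using True by (simp flip: 4(3))
  next
    case False
    then have "S \<noteq> []" using 4(3,4) avoids_patterns_descent[of m x a] by (cases S) auto
    then obtain S' where S: "S = t # S'" "stk = S' @ [m, a]" using 4(3) by (cases S) auto
    then show ?thesis using 4(2)[OF False S(2)] False 4(4) by auto
  qed
qed auto

section \<open>Permutations with the letters 1, ..., k in place\<close>

text \<open>The argument is the queue alone: the letters k, ..., 1 are determined by its length, so
  one step of the map acts on a prefix \<open>P\<close> and a list.\<close>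

fun countdown :: "nat list \<Rightarrow> nat list" where
  "countdown [] = []"
| "countdown (b # bs) = Suc (length bs) # b # countdown bs"

lemma length_countdown [simp]: "length (countdown bs) = 2 * length bs"
  by (induction bs) auto

lemma set_countdown: "set (countdown bs) = {1..length bs} \<union> set bs"
  by (induction bs) auto

lemma nth_countdown: "j < length bs \<Longrightarrow> countdown bs ! (2 * j) = length bs - j"
proof (induction bs arbitrary: j)
  case (Cons b bs)
  then show ?case by (cases j) auto
qed simp

text \<open>The letters from 1 to \<open>length bs\<close> already occur as counters, so by
  distinctness every other positive letter is larger.\<close>

lemma distinct_countdown_greater:
  assumes "distinct (P @ countdown bs)" "0 \<notin> set (P @ countdown bs)" "x \<in> set P \<union> set bs"
  shows "length bs < x"
proof -
  have "\<forall>x \<in> set bs. length bs < x" if "distinct (countdown bs)" "0 \<notin> set (countdown bs)"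
    using that
  proof (induction bs)
    case (Cons b bs)
    have b: "b \<notin> {0..Suc (length bs)}"
      using Cons.prems by (auto simp: set_countdown)
    have "Suc (length bs) < x" if "x \<in> set bs" for x
    proof -
      have "length bs < x" using Cons that by auto
      moreover have "x \<noteq> Suc (length bs)" using Cons.prems that by (auto simp: set_countdown)
      ultimately show ?thesis by simp
    qed
    with b show ?case by auto
  qed simp
  moreover have "x \<notin> {1..length bs}" if "x \<in> set P"
    using that assms(1) by (auto simp: set_countdown)
  moreover have "x \<noteq> 0" using assms(2,3) by (metis Un_iff set_append set_countdown)
  ultimately show ?thesis using assms by (cases "x \<in> set bs") auto
qed

text \<open>Each counter is smaller than everything before it, so it expels the previous queue
  letter and then the previous counter, and settles on \<open>a\<close>. Every queue letter thus
  moves ahead of its counter, and \<open>a\<close> comes out last.\<close>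

lemma stack_run_countdown:
  assumes "distinct (a # b # bs)" "\<And>x. x \<in> set (a # b # bs) \<Longrightarrow> Suc (length bs) < x"
  shows "stack_run patterns [Suc (length bs), a] (b # countdown bs) = b # countdown (bs @ [a])"
  using assms
proof (induction bs arbitrary: b)
  case Nil
  then show ?case by (simp add: avoids_patterns_descent)
next
  case (Cons c cs)
  let ?k = "Suc (length cs)"
  have "stack_run patterns [Suc ?k, a] (b # countdown (c # cs)) =
    stack_run patterns ([b, Suc ?k] @ [a]) (?k # c # countdown cs)"
    using Cons.prems by (simp add: avoids_patterns_descent)
  also have "\<dots> = [b, Suc ?k] @ stack_run patterns [a] (?k # c # countdown cs)"
  proof (rule stack_run_smaller)
    show "?k < x" if "x \<in> set [b, Suc ?k]" for x
      using that Cons.prems(2)[of b] by auto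
  qed (use Cons.prems in force)+
  also have "stack_run patterns [a] (?k # c # countdown cs) =
    stack_run patterns [?k, a] (c # countdown cs)"
    by (simp add: avoids_patterns_short)
  also have "\<dots> = c # countdown (cs @ [a])"
  proof (rule Cons.IH)
    show "?k < x" if "x \<in> set (a # c # cs)" for x
      using that Cons.prems(2)[of x] by auto
  qed (use Cons.prems in auto)
  finally show ?case by simp
qed

text \<open>The queue step. \<open>sort_map P\<close> ends with \<open>hd P\<close>; that letter
  joins the back of the queue instead, and the front \<open>q\<close> takes its place.\<close>

lemma sort_map_countdown:
  assumes "P \<noteq> []" "distinct (P @ countdown bs)" "0 \<notin> set (P @ countdown bs)"
    and queue: "bs @ [hd P] = q # qs"
  shows "sort_map (P @ countdown bs) = butlast (sort_map P) @ q # countdown qs"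
proof (cases bs)
  case Nil
  \<comment> \<open>With an empty queue \<open>q\<close> is \<open>hd P\<close> itself, which is the
    last letter of \<open>sort_map P\<close> anyway.\<close>
  then show ?thesis
    using queue last_sort_map[OF assms(1)] length_sort_map[of P] assms(1)
    by (metis append_Nil append_Nil2 append_butlast_last_id countdown.simps(1) length_0_conv
        list.inject)
next
  case (Cons b cs)
  have greater: "length bs < x" if "x \<in> set P \<union> set bs" for x
    using distinct_countdown_greater assms that by blast
  have dis: "distinct bs" if "distinct (countdown bs)" for bs
    using that by (induction bs) (auto simp: set_countdown)
  have "sort_map (P @ countdown bs) =
    butlast (sort_map P) @ stack_run patterns [Suc (length cs), hd P] (b # countdown cs)"
    using sort_map_append_smaller[of P "Suc (length cs)"] assms(1,2) greater Cons by auto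
  also have "stack_run patterns [Suc (length cs), hd P] (b # countdown cs) =
    b # countdown (cs @ [hd P])"
  proof (rule stack_run_countdown)
    show "distinct (hd P # b # cs)"
    proof -
      have "set P \<inter> set bs = {}" using assms(2) by (auto simp: set_countdown)
      then have "hd P \<notin> set bs" using hd_in_set[OF assms(1)] by blast
      then show ?thesis using dis[of bs] assms(2) Cons by auto
    qed
    show "Suc (length cs) < x" if "x \<in> set (hd P # b # cs)" for x
      using that greater[of x] Cons hd_in_set[OF assms(1)] by auto
  qed
  finally show ?thesis using queue Cons by simp
qed

section \<open>Half-decreasing permutations are rotated\<close>

text \<open>The definition fixes every second letter, counted from the end; what remains in front is
  one letter for odd length and two for even length.\<close>

lemma half_decreasing_iff_countdown:
  assumes "\<pi> \<noteq> []"
  shows "half_decreasing \<pi> \<longleftrightarrow> (\<exists>P bs. \<pi> = P @ countdown bs \<and> length P \<in> {1, 2})"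
proof
  assume hd: "half_decreasing \<pi>"
  have "\<exists>P bs. \<pi> = P @ countdown bs \<and> length bs = k" if "k \<le> (length \<pi> - 1) div 2" for k
    using that
  proof (induction k)
    case 0
    show ?case by (rule exI[of _ \<pi>], rule exI[of _ "[]"]) simp
  next
    case (Suc k)
    then obtain P bs where P: "\<pi> = P @ countdown bs" "length bs = k" by auto
    have len: "2 \<le> length P" using P Suc.prems assms by auto
    \<comment> \<open>This position is the last but one of \<open>P\<close>, so the last two letters
      of \<open>P\<close> can be moved into the countdown.\<close>
    have "\<pi> ! (length \<pi> - 2 * Suc k) = Suc k"
      using hd Suc.prems unfolding half_decreasing_def
      by (metis atLeastAtMost_iff le_add1 plus_1_eq_Suc)
    then have nth: "P ! (length P - 2) = Suc k" using P len by (simp add: nth_append split: if_splits)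
    have "P = take (length P - 2) P @ drop (length P - 2) P" by simp
    also have "drop (length P - 2) P = [P ! (length P - 2), P ! (length P - 1)]"
      using len by (intro nth_equalityI) (auto simp: less_Suc_eq Suc_diff_Suc numeral_2_eq_2)
    finally have "\<pi> = take (length P - 2) P @ countdown (P ! (length P - 1) # bs)"
      using P nth by (metis append_Cons append_Nil append_assoc countdown.simps(2))
    then show ?case using P by (metis length_Cons)
  qed
  from this[OF order_refl] obtain P bs where P: "\<pi> = P @ countdown bs"
    "length bs = (length \<pi> - 1) div 2" by blast
  have "length \<pi> = length P + 2 * length bs" by (simp add: P(1))
  moreover have "length \<pi> > 0" using assms by simp
  ultimately have "length P = 1 \<or> length P = 2" using P(2) by presburger
  then have "length P \<in> {1, 2}" by simp
  with P show "\<exists>P bs. \<pi> = P @ countdown bs \<and> length P \<in> {1, 2}" by blast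
next
  assume "\<exists>P bs. \<pi> = P @ countdown bs \<and> length P \<in> {1, 2}"
  then obtain P bs where P: "\<pi> = P @ countdown bs" "length P \<in> {1, 2}" by blast
  have len: "length \<pi> = length P + 2 * length bs" using P(1) by simp
  show "half_decreasing \<pi>"
    unfolding half_decreasing_def
  proof
    fix i assume "i \<in> {1..(length \<pi> - 1) div 2}"
    then have i: "1 \<le> i" "i \<le> length bs" using len P(2) by auto
    then have "length \<pi> - 2 * i = length P + 2 * (length bs - i)" using len by simp
    then have "\<pi> ! (length \<pi> - 2 * i) = countdown bs ! (2 * (length bs - i))"
      by (simp only: P(1) nth_append_length_plus)
    then show "\<pi> ! (length \<pi> - 2 * i) = i" using nth_countdown[of "length bs - i" bs] i by simp
  qed
qed

text \<open>Here \<open>xs\<close> is the prefix followed by the queue. The map fixes a one-letter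
  prefix and swaps a two-letter one, so the queue step becomes a rotation of
  \<open>xs\<close>.\<close>

lemma sort_map_half_decreasing:
  assumes "p \<in> {1, 2}" "p \<le> length xs"
    and "distinct (take p xs @ countdown (drop p xs))"
    and "0 \<notin> set (take p xs @ countdown (drop p xs))"
  shows "sort_map (take p xs @ countdown (drop p xs)) =
    take p (rotate1 xs) @ countdown (drop p (rotate1 xs))"
proof -
  obtain a ys where xs: "xs = a # ys" using assms(1,2) by (cases xs) auto
  show ?thesis
  proof (cases "p = 1")
    case True
    obtain q qs where q: "ys @ [a] = q # qs" by (cases "ys @ [a]") auto
    have "sort_map [a] = [a]" by (simp add: sort_map_Cons)
    then show ?thesis using sort_map_countdown[of "[a]" ys q qs] assms q True xs by simp
  next
    case False
    then obtain c zs where ys: "ys = c # zs" and p: "p = 2" using assms(1,2) xs by (cases ys) auto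
    obtain q qs where q: "zs @ [a] = q # qs" by (cases "zs @ [a]") auto
    have "sort_map [a, c] = [c, a]" by (simp add: sort_map_Cons avoids_patterns_short)
    then show ?thesis using sort_map_countdown[of "[a, c]" zs q qs] assms q p xs ys by simp
  qed
qed

lemma funpow_sort_map_half_decreasing:
  assumes "p \<in> {1, 2}" "p \<le> length xs"
    and "distinct (take p xs @ countdown (drop p xs))"
    and "0 \<notin> set (take p xs @ countdown (drop p xs))"
  shows "(sort_map ^^ j) (take p xs @ countdown (drop p xs)) =
    take p (rotate j xs) @ countdown (drop p (rotate j xs))"
proof (induction j)
  case (Suc j)
  let ?\<pi> = "take p (rotate j xs) @ countdown (drop p (rotate j xs))"
  have "distinct ?\<pi> \<and> 0 \<notin> set ?\<pi>"
    \<comment> \<open>Read as an iterate, the rotated permutation inherits both properties, because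
      the map only rearranges letters.\<close>
    unfolding Suc.IH[symmetric] using assms(3,4)
    by (induction j)
      (simp_all only: funpow.simps id_apply o_apply distinct_sort_map set_sort_map simp_thms)
  then show ?case
    using sort_map_half_decreasing[of p "rotate j xs"] assms(1,2) Suc.IH by simp
qed simp

lemma half_decreasing_obtain:
  assumes "\<pi> \<noteq> []" "half_decreasing \<pi>"
  obtains p xs where "p \<in> {1, 2}" "p \<le> length xs" "\<pi> = take p xs @ countdown (drop p xs)"
proof -
  obtain P bs where "\<pi> = P @ countdown bs" "length P \<in> {1, 2}"
    using half_decreasing_iff_countdown assms by blast
  then show thesis using that[of "length P" "P @ bs"] by simp
qed

lemma half_decreasing_funpow:
  assumes "half_decreasing \<pi>" "\<pi> \<noteq> []" "distinct \<pi>" "0 \<notin> set \<pi>"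
  shows "half_decreasing ((sort_map ^^ j) \<pi>)"
proof -
  obtain p xs where p: "p \<in> {1, 2}" "p \<le> length xs" "\<pi> = take p xs @ countdown (drop p xs)"
    using half_decreasing_obtain assms by blast
  have eq: "(sort_map ^^ j) \<pi> = take p (rotate j xs) @ countdown (drop p (rotate j xs))"
    using funpow_sort_map_half_decreasing p assms by blast
  have "length (take p (rotate j xs)) \<in> {1, 2}" using p by auto
  moreover from this have "(sort_map ^^ j) \<pi> \<noteq> []" using eq by auto
  ultimately show ?thesis using half_decreasing_iff_countdown eq by blast
qed

lemma half_decreasing_periodic:
  assumes "half_decreasing \<pi>" "\<pi> \<noteq> []" "distinct \<pi>" "0 \<notin> set \<pi>"
  shows "\<exists>k>0. (sort_map ^^ k) \<pi> = \<pi>"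
proof -
  obtain p xs where p: "p \<in> {1, 2}" "p \<le> length xs" "\<pi> = take p xs @ countdown (drop p xs)"
    using half_decreasing_obtain assms by blast
  \<comment> \<open>Rotating \<open>xs\<close> as many times as it has letters restores it.\<close>
  then have "(sort_map ^^ length xs) \<pi> = \<pi>"
    using funpow_sort_map_half_decreasing[of p xs "length xs"] assms by simp
  moreover have "length xs > 0" using p by auto
  ultimately show ?thesis by blast
qed

section \<open>Placing the letter k + 1\<close>

text \<open>The letter k + 1 is the least of \<open>P\<close>, so it settles directly on
  \<open>a\<close> and stays there. It ends up just before \<open>a\<close>, and after the queue
  step just before \<open>q\<close>, which is its place.\<close>

lemma sort_map_places_next:
  assumes "distinct (P @ countdown bs)" "0 \<notin> set (P @ countdown bs)"
    and "P = a # X @ Suc (length bs) # Y"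
  shows "\<exists>P' bs'. sort_map (P @ countdown bs) = P' @ countdown bs' \<and> length bs' = Suc (length bs)"
proof -
  let ?m = "Suc (length bs)"
  obtain q qs where q: "bs @ [hd P] = q # qs" by (cases "bs @ [hd P]") auto
  have len: "length qs = length bs" using arg_cong[OF q, of length] by simp
  have greater: "?m < x" if "x \<in> set (a # X @ Y)" for x
  proof -
    have "length bs < x" using distinct_countdown_greater[OF assms(1,2), of x] that assms(3) by auto
    moreover have "x \<noteq> ?m" using that assms(1,3) by auto
    ultimately show ?thesis by simp
  qed
  have "sort_map P = butlast (sort_map (a # X)) @ stack_run patterns [?m, a] Y"
    using sort_map_append_smaller[of "a # X" ?m Y] assms greater by auto
  moreover obtain Z where "stack_run patterns [?m, a] Y = Z @ [?m, a]"
    using stack_run_keeps_bottom[of Y ?m "[]" a] greater by auto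
  ultimately have "butlast (sort_map P) = (butlast (sort_map (a # X)) @ Z) @ [?m]"
    by (simp add: butlast_append)
  then have "sort_map (P @ countdown bs) =
    (butlast (sort_map (a # X)) @ Z) @ countdown (q # qs)"
    using sort_map_countdown[OF _ assms(1,2) q] assms(3) len by simp
  then show ?thesis using len by (metis length_Cons)
qed

text \<open>Induction on the letters \<open>xs\<close> ahead of k + 1 in the queue; each step
  removes the first of them.\<close>

lemma eventually_places_queued:
  assumes "distinct (P @ countdown bs)" "0 \<notin> set (P @ countdown bs)" "length P \<ge> 3"
    and "bs @ [hd P] = xs @ Suc (length bs) # ys"
  shows "\<exists>j P' bs'. (sort_map ^^ j) (P @ countdown bs) = P' @ countdown bs' \<and>
    length bs' = Suc (length bs)"
  using assms
proof (induction xs arbitrary: P bs ys)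
  case Nil
  let ?P = "butlast (sort_map P) @ [Suc (length bs)]"
  have step: "sort_map (P @ countdown bs) = ?P @ countdown ys"
    using sort_map_countdown[OF _ Nil(1,2) Nil(4)[simplified append_Nil]] Nil(3) by fastforce
  have len: "length ys = length bs" using arg_cong[OF Nil(4), of length] by simp
  \<comment> \<open>So k + 1, which has just left the queue, is not the first letter of the new
    prefix, and the next step places it.\<close>
  have "length (butlast (sort_map P)) \<ge> 2" using Nil(3) by (simp add: length_sort_map)
  then obtain a X where "butlast (sort_map P) = a # X" by (cases "butlast (sort_map P)") auto
  then have "?P = a # X @ Suc (length ys) # []" using len by simp
  moreover have "distinct (?P @ countdown ys)" "0 \<notin> set (?P @ countdown ys)"
    unfolding step[symmetric] using Nil by (simp_all only: distinct_sort_map set_sort_map simp_thms)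
  ultimately obtain P' bs' where
    "sort_map (?P @ countdown ys) = P' @ countdown bs'" "length bs' = Suc (length ys)"
    using sort_map_places_next by blast
  then have "(sort_map ^^ 2) (P @ countdown bs) = P' @ countdown bs'"
    using step by (simp add: numeral_2_eq_2)
  with \<open>length bs' = _\<close> len show ?case by metis
next
  case (Cons x xs)
  let ?P = "butlast (sort_map P) @ [x]" and ?bs = "xs @ Suc (length bs) # ys"
  have step: "sort_map (P @ countdown bs) = ?P @ countdown ?bs"
    using sort_map_countdown[OF _ Cons.prems(1,2) Cons.prems(4)[simplified append_Cons]] Cons.prems(3)
    by fastforce
  have len: "length ?bs = length bs" using arg_cong[OF Cons.prems(4), of length] by simp
  have "\<exists>j P' bs'. (sort_map ^^ j) (?P @ countdown ?bs) = P' @ countdown bs' \<and>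
    length bs' = Suc (length ?bs)"
  proof (rule Cons.IH)
    show "distinct (?P @ countdown ?bs)" "0 \<notin> set (?P @ countdown ?bs)"
      unfolding step[symmetric] using Cons.prems
      by (simp_all only: distinct_sort_map set_sort_map simp_thms)
    show "length ?P \<ge> 3" using Cons.prems(3) by (simp add: length_sort_map)
    \<comment> \<open>The first letter of the new prefix is appended behind k + 1, so it does not
      delay that letter.\<close>
    show "?bs @ [hd ?P] = xs @ Suc (length ?bs) # (ys @ [hd ?P])" unfolding len by simp
  qed
  then obtain j P' bs' where "(sort_map ^^ j) (?P @ countdown ?bs) = P' @ countdown bs'"
    "length bs' = Suc (length ?bs)" by blast
  then have "(sort_map ^^ Suc j) (P @ countdown bs) = P' @ countdown bs'"
    using step by (simp add: funpow_swap1)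
  with \<open>length bs' = _\<close> len show ?case by metis
qed

lemma eventually_places_next:
  assumes "distinct (P @ countdown bs)" "set (P @ countdown bs) = {1..n}" "length P \<ge> 3"
  shows "\<exists>j P' bs'. (sort_map ^^ j) (P @ countdown bs) = P' @ countdown bs' \<and>
    length bs' = Suc (length bs)"
proof -
  let ?m = "Suc (length bs)"
  have zero: "0 \<notin> set (P @ countdown bs)" unfolding assms(2) by simp
  have "n = length (P @ countdown bs)"
    using distinct_card[OF assms(1)] unfolding assms(2) by simp
  \<comment> \<open>The length is \<open>length P + 2 * length bs\<close>, which is at least k +
    1.\<close>
  then have "?m \<in> set (P @ countdown bs)" unfolding assms(2) using assms(3) by auto
  then have "?m \<in> set (tl P) \<or> ?m \<in> set (bs @ [hd P])"
    by (cases P) (auto simp: set_countdown)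
  then show ?thesis
  proof
    assume "?m \<in> set (tl P)"
    then obtain X Y where "tl P = X @ ?m # Y" by (meson split_list)
    then have "P = hd P # X @ ?m # Y" using assms(3) by (cases P) auto
    then obtain P' bs' where "sort_map (P @ countdown bs) = P' @ countdown bs'" "length bs' = ?m"
      using sort_map_places_next[OF assms(1) zero] by blast
    then have "(sort_map ^^ 1) (P @ countdown bs) = P' @ countdown bs'" by simp
    then show ?thesis using \<open>length bs' = ?m\<close> by blast
  next
    assume "?m \<in> set (bs @ [hd P])"
    then obtain xs ys where "bs @ [hd P] = xs @ ?m # ys" by (meson split_list)
    then show ?thesis using eventually_places_queued[OF assms(1) zero assms(3)] by blast
  qed
qed

section \<open>Every orbit becomes half-decreasing\<close>

lemma funpow_sort_map_permutation:
  "\<pi> \<in> permutations_of_set A \<Longrightarrow> (sort_map ^^ j) \<pi> \<in> permutations_of_set A"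
  by (induction j) (simp_all add: stack_map_permutation[OF length_ge_2_patterns])

lemma eventually_half_decreasing:
  assumes "\<pi> \<in> permutations_of_set {1..n}" "n \<ge> 1"
  shows "\<exists>j. half_decreasing ((sort_map ^^ j) \<pi>)"
proof -
  have "\<exists>j P bs. (sort_map ^^ j) \<pi> = P @ countdown bs \<and> length bs = k" if "k \<le> (n - 1) div 2" for k
    using that
  proof (induction k)
    case 0
    have "(sort_map ^^ 0) \<pi> = \<pi> @ countdown []" by simp
    then show ?case by (metis list.size(3))
  next
    case (Suc k)
    then obtain j P bs where j: "(sort_map ^^ j) \<pi> = P @ countdown bs" "length bs = k" by auto
    have perm: "P @ countdown bs \<in> permutations_of_set {1..n}"
      using funpow_sort_map_permutation[OF assms(1), of j] j(1) by simp
    have "length (P @ countdown bs) = n" using length_finite_permutations_of_set[OF perm] by simp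
    \<comment> \<open>From k + 1 \<le> (n - 1) div 2 follows n \<ge> 2k + 3, and the countdown takes
      up 2k of these letters.\<close>
    then have "length P \<ge> 3" using j(2) Suc.prems by simp
    then obtain i P' bs' where "(sort_map ^^ i) (P @ countdown bs) = P' @ countdown bs'"
      "length bs' = Suc (length bs)"
      using eventually_places_next permutations_of_setD[OF perm] by blast
    then have "(sort_map ^^ (i + j)) \<pi> = P' @ countdown bs'" "length bs' = Suc k"
      using j by (simp_all add: funpow_add)
    then show ?case by blast
  qed
  then obtain j P bs where j: "(sort_map ^^ j) \<pi> = P @ countdown bs" "length bs = (n - 1) div 2"
    by blast
  have "length (P @ countdown bs) = n"
    using length_finite_permutations_of_set[OF funpow_sort_map_permutation[OF assms(1), of j]] j
    by simp
  then have P: "length P + 2 * ((n - 1) div 2) = n" using j(2) by simp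
  have "length P \<in> {1, 2}" using P assms(2) by simp presburger
  moreover from this have "(sort_map ^^ j) \<pi> \<noteq> []" using j by auto
  ultimately have "half_decreasing ((sort_map ^^ j) \<pi>)" using half_decreasing_iff_countdown j by blast
  then show ?thesis ..
qed

theorem theorem4p1:
  fixes n :: nat
  assumes "n \<ge> 1"
  shows "periodic_points (stack_map {[1, 2, 3], [1, 3, 2]}) (permutations_of_set {1..n})
           = {\<pi> \<in> permutations_of_set {1..n}. half_decreasing \<pi>}"
proof -
  have facts: "\<pi> \<noteq> []" "distinct \<pi>" "0 \<notin> set \<pi>" if "\<pi> \<in> permutations_of_set {1..n}" for \<pi>
    using permutations_of_setD[OF that] assms by auto
  have "half_decreasing \<pi>"
    if \<pi>: "\<pi> \<in> permutations_of_set {1..n}" and k: "k > 0" "(sort_map ^^ k) \<pi> = \<pi>" for \<pi> k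
  proof -
    obtain j where j: "half_decreasing ((sort_map ^^ j) \<pi>)"
      using eventually_half_decreasing[OF \<pi> assms] by blast
    \<comment> \<open>A multiple of the period that is at least \<open>j\<close>: it makes \<pi> an
      iterate of its half-decreasing \<open>j\<close>-th image.\<close>
    have "(sort_map ^^ (k * j)) \<pi> = \<pi>"
      by (induction j) (simp_all add: funpow_add k(2))
    moreover have "k * j = (k * j - j) + j" using k(1) by simp
    ultimately have "(sort_map ^^ (k * j - j)) ((sort_map ^^ j) \<pi>) = \<pi>"
      by (metis comp_apply funpow_add)
    then show ?thesis
      using half_decreasing_funpow[OF j facts[OF funpow_sort_map_permutation[OF \<pi>]]] by metis
  qed
  then show ?thesis
    unfolding periodic_points_def patterns_def[symmetric] using half_decreasing_periodic facts by blast
qed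

end
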